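(* Assume the Runge--Kutta matrices $(a_{ij})_{i,j=1}^s$ and $(\tilde a_{\alpha\beta})_{\alpha,\beta=1}^\sigma$ are invertible. The method arising from approximating the internal stages with the partitioned Runge--Kutta expansion is well-defined if and only if the partitioned Runge--Kutta method is symplectic in both space and time, i.e. $$\sum_{j,l}b_ja'_{jk}(a^{-1})_{jl}=b'_k\quad(k=1,\dots,s),\qquad \sum_{\beta,\gamma}\tilde b_\beta\tilde a'_{\beta\alpha}(\tilde a^{-1})_{\beta\gamma}=\tilde b'_\alpha\quad(\alpha=1,\dots,\sigma).$$ A sufficient condition is the usual choice of symplectic partitioned Runge--Kutta coefficients $$a'_{jk}=\frac{b'_ka_{kj}}{b_j},\qquad \tilde a'_{\beta\alpha}=\frac{\tilde b'_\alpha\tilde a_{\alpha\beta}}{\tilde b_\beta}.$$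
   Context: Setting: $\Box=[0,\Delta t]\times[0,\Delta x]$ with $\Delta t,\Delta x>0$; $Q\neq0$ is a finite-dimensional real vector space; $H=H(\phi,p^0,p^1)$ is a smooth Hamiltonian on $Q\times Q^*\times Q^*$; juxtaposition $\pi\varphi$ denotes the duality pairing. Fix distinct nodes $c_i\in[0,1]$ ($i=1,\dots,s$) and $\tilde c_\alpha\in[0,1]$ ($\alpha=1,\dots,\sigma$), and basis functions $\psi_i,\tilde\psi_\alpha$ on $[0,1]$ with $\psi_i(c_j)=\delta_{ij}$, $\tilde\psi_\alpha(\tilde c_\beta)=\delta_{\alpha\beta}$. Put $a_{ij}=\int_0^{c_i}\psi_j(s)\,ds$, $\tilde a_{\alpha\beta}=\int_0^{\tilde c_\alpha}\tilde\psi_\beta(s)\,ds$, $b_i=\int_0^1\psi_i(s)\,ds$, $\tilde b_\alpha=\int_0^1\tilde\psi_\alpha(s)\,ds$, with $b_i\ne0$, $\tilde b_\alpha\neq0$, $\sum_ib_i=1=\sum_\alpha\tilde b_\alpha$. Let $a'_{ij},\tilde a'_{\alpha\beta}\in\mathbb R$ and $b'_j,\tilde b'_\beta>0$ with $\sum_jb'_j=1=\sum_\beta\tilde b'_\beta$ be further coefficients (for the momenta), and let $\theta\in\mathbb R$ be a fixed arbitrary parameter. Boundary data: field values $\varphi_{0[\alpha]}$ at $(0,\tilde c_\alpha\Delta x)$ and $\varphi_{[i]0}$ at $(c_i\Delta t,0)$ in $Q$; normal momenta $\pi^0_{1[\alpha]}$ at $(\Delta t,\tilde c_\alpha\Delta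 x)$ and $\pi^1_{[i]1}$ at $(c_i\Delta t,\Delta x)$ in $Q^*$. Internal variables: $V^{i\alpha},W^{i\alpha}\in Q$ and $X^{i\alpha},Y^{i\alpha},\lambda_{i\alpha}\in Q^*$. Partitioned Runge--Kutta expansions of the internal stages: $$\Phi_{i\alpha}=\varphi_{0[\alpha]}+\Delta t\sum_ja_{ij}V^{j\alpha},\quad \tilde\Phi_{i\alpha}=\varphi_{[i]0}+\Delta x\sum_\beta\tilde a_{\alpha\beta}W^{i\beta},$$ $$P^0_{i\alpha}=\pi^0_{1[\alpha]}-\Delta t\sum_ja'_{ij}X^{j\alpha},\quad P^1_{i\alpha}=\pi^1_{[i]1}-\Delta x\sum_\beta\tilde a'_{\alpha\beta}Y^{i\beta},\quad \Phi^\theta_{i\alpha}=\theta\Phi_{i\alpha}+(1-\theta)\tilde\Phi_{i\alpha}.$$ Momenta expansions of the unknown boundary momenta: $$\pi^0_{0[\alpha]}=\pi^0_{1[\alpha]}-\Delta t\sum_jb'_jX^{j\alpha},\qquad \pi^1_{[i]0}=\pi^1_{[i]1}-\Delta x\sum_\beta\tilde b'_\beta Y^{i\beta}.\qquad(\ast)$$ Define $$\begin{aligned}K={}&\Delta x\sum_\alpha\tilde b_\alpha\pi^0_{1[\alpha]}\Big(\varphi_{0[\alpha]}+\Delta t\sum_jb_jV^{j\alpha}\Big)+\Delta t\sum_ib_i\pi^1_{[i]1}\Big(\varphi_{[i]0}+\Delta x\sum_\beta\tilde b_\beta W^{i\beta}\Big)\\&-\Delta t\Delta x\sum_{i,\alpha}b_i\tilde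 b_\alpha P^0_{i\alpha}V^{i\alpha}-\Delta t\Delta x\sum_{i,\alpha}b_i\tilde b_\alpha P^1_{i\alpha}W^{i\alpha}\\&+\Delta t\Delta x\sum_{i,\alpha}b_i\tilde b_\alpha H(\Phi^\theta_{i\alpha},P^0_{i\alpha},P^1_{i\alpha})+\sum_{i,\alpha}\lambda_{i\alpha}(\Phi_{i\alpha}-\tilde\Phi_{i\alpha}).\end{aligned}$$ The discrete boundary Hamiltonian $H_d^+$ is the extremal value of $K$ over the internal variables $\{V^{i\alpha},W^{i\alpha},X^{i\alpha},Y^{i\alpha},\lambda_{i\alpha}\}$ at fixed boundary data. The discrete forward Hamilton's equations for the boundary momenta are $$\pi^0_{0[\alpha]}=\frac{1}{\tilde b_\alpha\Delta x}\frac{\partial K}{\partial\varphi_{0[\alpha]}},\qquad \pi^1_{[i]0}=\frac{1}{b_i\Delta t}\frac{\partial K}{\partial\varphi_{[i]0}}\qquad(\ast\ast)$$ evaluated at a stationary point of $K$ with respect to the internal variables (partial derivatives with the internal variables held fixed; these equal the derivatives of $H_d^+$). Well-defined: the method (i.e. the choice of coefficients) is called well-defined if the boundary momenta given by $(\ast\ast)$ agree with those given by the expansions $(\ast)$, for all smooth Hamiltonians $H$, all boundary data and all stationary points of $K$ in the internal variables (so that the values of $X^{i\alpha},Y^{i\alpha}$ are arbitrary). *)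

theory Defs
  imports "HOL-Analysis.Analysis"
begin

text \<open>
  The configuration space \<open>Q\<close> is a type \<open>'q :: euclidean_space\<close>; this class entails
  \<open>0 < DIM('q)\<close>, hence \<open>Q \<noteq> 0\<close>. The inner product is never used. Since all linear
  functionals on \<open>'q\<close> are bounded, the dual space is the type of bounded linear functionals,
  and the duality pairing is \<^const>\<open>blinfun_apply\<close>.

  The temporal index \<open>i\<close> ranges over a finite type \<open>'s\<close> and the spatial index \<open>\<alpha>\<close> over a
  finite type \<open>'r\<close>.
\<close>

type_synonym 'q dual = "'q \<Rightarrow>\<^sub>L real"


section \<open>Smooth functions\<close>

text \<open>
  On a finite-dimensional domain, \<open>f\<close> is of class \<open>C\<^sup>n\<^sup>+\<^sup>1\<close> iff it is differentiable and all its
  directional derivatives are of class \<open>C\<^sup>n\<close>.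
\<close>

primrec C_diff :: "nat \<Rightarrow> ('a::real_normed_vector \<Rightarrow> 'b::real_normed_vector) \<Rightarrow> bool" where
  "C_diff 0 f \<longleftrightarrow> continuous_on UNIV f"
| "C_diff (Suc n) f \<longleftrightarrow> (\<forall>x. f differentiable (at x)) \<and>
     (\<forall>v. C_diff n (\<lambda>x. frechet_derivative f (at x) v))"

definition smooth :: "('a::real_normed_vector \<Rightarrow> 'b::real_normed_vector) \<Rightarrow> bool" where
  "smooth f \<longleftrightarrow> (\<forall>n. C_diff n f)"


section \<open>Partitioned Runge--Kutta coefficients in one direction\<close>

text \<open>
  \<open>rk_A\<close> and \<open>rk_b\<close> are the coefficients \<open>a\<close>, \<open>b\<close> for the field; \<open>mom_A\<close> and \<open>mom_b\<close> are the
  coefficients \<open>a'\<close>, \<open>b'\<close> for the momentum. The entry \<open>a\<^sub>i\<^sub>j\<close> is \<open>rk_A T $ i $ j\<close>.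
\<close>

record 'n prk =
  rk_A :: "real^'n^'n"
  rk_b :: "'n \<Rightarrow> real"
  mom_A :: "real^'n^'n"
  mom_b :: "'n \<Rightarrow> real"

definition collocation_prk ::
  "('n::finite \<Rightarrow> real) \<Rightarrow> ('n \<Rightarrow> real \<Rightarrow> real) \<Rightarrow> real^'n^'n \<Rightarrow> ('n \<Rightarrow> real) \<Rightarrow> 'n prk"
  where
  "collocation_prk c \<psi> A' b' =
     \<lparr> rk_A = (\<chi> i j. integral {0..c i} (\<psi> j)),
       rk_b = (\<lambda>i. integral {0..1} (\<psi> i)),
       mom_A = A',
       mom_b = b' \<rparr>"

definition nodal_basis :: "('n::finite \<Rightarrow> real) \<Rightarrow> ('n \<Rightarrow> real \<Rightarrow> real) \<Rightarrow> bool" where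
  "nodal_basis c \<psi> \<longleftrightarrow>
     inj c \<and> (\<forall>i. c i \<in> {0..1}) \<and>
     (\<forall>i. \<psi> i integrable_on {0..1}) \<and>
     (\<forall>i j. \<psi> i (c j) = (if i = j then 1 else 0))"

definition admissible_weights :: "'n::finite prk \<Rightarrow> bool" where
  "admissible_weights T \<longleftrightarrow>
     (\<forall>i. rk_b T i \<noteq> 0) \<and> (\<Sum>i\<in>UNIV. rk_b T i) = 1 \<and>
     (\<forall>j. 0 < mom_b T j) \<and> (\<Sum>j\<in>UNIV. mom_b T j) = 1"

definition symplectic :: "'n::finite prk \<Rightarrow> bool" where
  "symplectic T \<longleftrightarrow>
     (\<forall>k. (\<Sum>j\<in>UNIV. \<Sum>l\<in>UNIV. rk_b T j * mom_A T $ j $ k * matrix_inv (rk_A T) $ j $ l)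
            = mom_b T k)"

definition usual_symplectic_choice :: "'n::finite prk \<Rightarrow> bool" where
  "usual_symplectic_choice T \<longleftrightarrow>
     (\<forall>j k. mom_A T $ j $ k = mom_b T k * rk_A T $ k $ j / rk_b T j)"


section \<open>The discrete action on a space-time rectangle\<close>

text \<open>
  Throughout, \<open>T\<close> holds the temporal and \<open>S\<close> the spatial coefficients. The boundary data are
  \<open>\<phi>0 $ \<alpha> = \<phi>\<^sub>0\<^sub>[\<^sub>\<alpha>\<^sub>]\<close>, \<open>\<phi>1 $ i = \<phi>\<^sub>[\<^sub>i\<^sub>]\<^sub>0\<close>, \<open>\<pi>0 $ \<alpha> = \<pi>\<^sup>0\<^sub>1\<^sub>[\<^sub>\<alpha>\<^sub>]\<close>, \<open>\<pi>1 $ i = \<pi>\<^sup>1\<^sub>[\<^sub>i\<^sub>]\<^sub>1\<close>.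
\<close>

definition \<Phi>_time ::
  "real \<Rightarrow> 's::finite prk \<Rightarrow> 'q::euclidean_space^'r::finite \<Rightarrow> 'q^'r^'s \<Rightarrow> 's \<Rightarrow> 'r \<Rightarrow> 'q" where
  "\<Phi>_time dt T \<phi>0 V i \<alpha> = \<phi>0 $ \<alpha> + dt *\<^sub>R (\<Sum>j\<in>UNIV. rk_A T $ i $ j *\<^sub>R V $ j $ \<alpha>)"

definition \<Phi>_space ::
  "real \<Rightarrow> 'r::finite prk \<Rightarrow> 'q::euclidean_space^'s::finite \<Rightarrow> 'q^'r^'s \<Rightarrow> 's \<Rightarrow> 'r \<Rightarrow> 'q" where
  "\<Phi>_space dx S \<phi>1 W i \<alpha> = \<phi>1 $ i + dx *\<^sub>R (\<Sum>\<beta>\<in>UNIV. rk_A S $ \<alpha> $ \<beta> *\<^sub>R W $ i $ \<beta>)"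

definition P_time ::
  "real \<Rightarrow> 's::finite prk \<Rightarrow> ('q::euclidean_space dual)^'r::finite \<Rightarrow> ('q dual)^'r^'s
     \<Rightarrow> 's \<Rightarrow> 'r \<Rightarrow> 'q dual" where
  "P_time dt T \<pi>0 X i \<alpha> = \<pi>0 $ \<alpha> - dt *\<^sub>R (\<Sum>j\<in>UNIV. mom_A T $ i $ j *\<^sub>R X $ j $ \<alpha>)"

definition P_space ::
  "real \<Rightarrow> 'r::finite prk \<Rightarrow> ('q::euclidean_space dual)^'s::finite \<Rightarrow> ('q dual)^'r^'s
     \<Rightarrow> 's \<Rightarrow> 'r \<Rightarrow> 'q dual" where
  "P_space dx S \<pi>1 Y i \<alpha> = \<pi>1 $ i - dx *\<^sub>R (\<Sum>\<beta>\<in>UNIV. mom_A S $ \<alpha> $ \<beta> *\<^sub>R Y $ i $ \<beta>)"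

text \<open>The internal variables \<open>(V, W, X, Y, \<lambda>)\<close>.\<close>

type_synonym ('q, 's, 'r) internal =
  "('q^'r^'s) \<times> ('q^'r^'s) \<times> ('q dual^'r^'s) \<times> ('q dual^'r^'s) \<times> ('q dual^'r^'s)"

definition K ::
  "real \<Rightarrow> real \<Rightarrow> real \<Rightarrow> 's::finite prk \<Rightarrow> 'r::finite prk
   \<Rightarrow> ('q::euclidean_space \<times> 'q dual \<times> 'q dual \<Rightarrow> real)
   \<Rightarrow> 'q^'r \<Rightarrow> 'q^'s \<Rightarrow> ('q dual)^'r \<Rightarrow> ('q dual)^'s
   \<Rightarrow> ('q, 's, 'r) internal \<Rightarrow> real" where
  "K dt dx \<theta> T S H \<phi>0 \<phi>1 \<pi>0 \<pi>1 = (\<lambda>(V, W, X, Y, lam).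
     let \<Phi> = \<Phi>_time dt T \<phi>0 V; \<Phi>' = \<Phi>_space dx S \<phi>1 W;
         P0 = P_time dt T \<pi>0 X; P1 = P_space dx S \<pi>1 Y;
         \<Phi>\<theta> = (\<lambda>i \<alpha>. \<theta> *\<^sub>R \<Phi> i \<alpha> + (1 - \<theta>) *\<^sub>R \<Phi>' i \<alpha>)
     in dx * (\<Sum>\<alpha>\<in>UNIV. rk_b S \<alpha> *
               blinfun_apply (\<pi>0 $ \<alpha>) (\<phi>0 $ \<alpha> + dt *\<^sub>R (\<Sum>j\<in>UNIV. rk_b T j *\<^sub>R V $ j $ \<alpha>)))
      + dt * (\<Sum>i\<in>UNIV. rk_b T i *
               blinfun_apply (\<pi>1 $ i) (\<phi>1 $ i + dx *\<^sub>R (\<Sum>\<beta>\<in>UNIV. rk_b S \<beta> *\<^sub>R W $ i $ \<beta>)))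
      - dt * dx * (\<Sum>i\<in>UNIV. \<Sum>\<alpha>\<in>UNIV.
               rk_b T i * rk_b S \<alpha> * blinfun_apply (P0 i \<alpha>) (V $ i $ \<alpha>))
      - dt * dx * (\<Sum>i\<in>UNIV. \<Sum>\<alpha>\<in>UNIV.
               rk_b T i * rk_b S \<alpha> * blinfun_apply (P1 i \<alpha>) (W $ i $ \<alpha>))
      + dt * dx * (\<Sum>i\<in>UNIV. \<Sum>\<alpha>\<in>UNIV.
               rk_b T i * rk_b S \<alpha> * H (\<Phi>\<theta> i \<alpha>, P0 i \<alpha>, P1 i \<alpha>))
      + (\<Sum>i\<in>UNIV. \<Sum>\<alpha>\<in>UNIV. blinfun_apply (lam $ i $ \<alpha>) (\<Phi> i \<alpha> - \<Phi>' i \<alpha>)))"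

definition stationary_point :: "('a::real_normed_vector \<Rightarrow> real) \<Rightarrow> 'a \<Rightarrow> bool" where
  "stationary_point f z \<longleftrightarrow> (f has_derivative (\<lambda>h. 0)) (at z)"


section \<open>Boundary momenta and well-definedness\<close>

text \<open>The derivative of a differentiable function as an element of the dual space.\<close>

definition dual_derivative :: "('q::euclidean_space \<Rightarrow> real) \<Rightarrow> 'q \<Rightarrow> 'q dual" where
  "dual_derivative f x = Blinfun (frechet_derivative f (at x))"

text \<open>
  The boundary momenta \<open>\<pi>\<^sup>0\<^sub>0\<^sub>[\<^sub>\<alpha>\<^sub>]\<close> and \<open>\<pi>\<^sup>1\<^sub>[\<^sub>i\<^sub>]\<^sub>0\<close> according to the discrete forward Hamilton's
  equations; only the component \<open>\<phi>0 $ \<alpha>\<close> (resp. \<open>\<phi>1 $ i\<close>) varies in the partial derivative.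
\<close>

definition hamilton_momentum_time where
  "hamilton_momentum_time dt dx \<theta> T S H \<phi>0 \<phi>1 \<pi>0 \<pi>1 z \<alpha> =
     (1 / (rk_b S \<alpha> * dx)) *\<^sub>R
       dual_derivative
         (\<lambda>q. K dt dx \<theta> T S H (\<chi> \<beta>. if \<beta> = \<alpha> then q else \<phi>0 $ \<beta>) \<phi>1 \<pi>0 \<pi>1 z) (\<phi>0 $ \<alpha>)"

definition hamilton_momentum_space where
  "hamilton_momentum_space dt dx \<theta> T S H \<phi>0 \<phi>1 \<pi>0 \<pi>1 z i =
     (1 / (rk_b T i * dt)) *\<^sub>R
       dual_derivative
         (\<lambda>q. K dt dx \<theta> T S H \<phi>0 (\<chi> j. if j = i then q else \<phi>1 $ j) \<pi>0 \<pi>1 z) (\<phi>1 $ i)"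

text \<open>The same boundary momenta according to the Runge--Kutta expansions of the momenta.\<close>

definition expansion_momentum_time ::
  "real \<Rightarrow> 's::finite prk \<Rightarrow> ('q::euclidean_space dual)^'r::finite \<Rightarrow> ('q dual)^'r^'s
     \<Rightarrow> 'r \<Rightarrow> 'q dual" where
  "expansion_momentum_time dt T \<pi>0 X \<alpha> =
     \<pi>0 $ \<alpha> - dt *\<^sub>R (\<Sum>j\<in>UNIV. mom_b T j *\<^sub>R X $ j $ \<alpha>)"

definition expansion_momentum_space ::
  "real \<Rightarrow> 'r::finite prk \<Rightarrow> ('q::euclidean_space dual)^'s::finite \<Rightarrow> ('q dual)^'r^'s
     \<Rightarrow> 's \<Rightarrow> 'q dual" where
  "expansion_momentum_space dx S \<pi>1 Y i =
     \<pi>1 $ i - dx *\<^sub>R (\<Sum>\<beta>\<in>UNIV. mom_b S \<beta> *\<^sub>R Y $ i $ \<beta>)"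

definition well_defined_method ::
  "'q::euclidean_space itself \<Rightarrow> real \<Rightarrow> real \<Rightarrow> real \<Rightarrow> 's::finite prk \<Rightarrow> 'r::finite prk \<Rightarrow> bool"
  where
  "well_defined_method _ dt dx \<theta> T S \<longleftrightarrow>
     (\<forall>(H :: 'q \<times> 'q dual \<times> 'q dual \<Rightarrow> real) \<phi>0 \<phi>1 \<pi>0 \<pi>1 V W X Y lam.
        smooth H \<longrightarrow>
        stationary_point (K dt dx \<theta> T S H \<phi>0 \<phi>1 \<pi>0 \<pi>1) (V, W, X, Y, lam) \<longrightarrow>
        (\<forall>\<alpha>. hamilton_momentum_time dt dx \<theta> T S H \<phi>0 \<phi>1 \<pi>0 \<pi>1 (V, W, X, Y, lam) \<alpha>
               = expansion_momentum_time dt T \<pi>0 X \<alpha>) \<and>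
        (\<forall>i. hamilton_momentum_space dt dx \<theta> T S H \<phi>0 \<phi>1 \<pi>0 \<pi>1 (V, W, X, Y, lam) i
               = expansion_momentum_space dx S \<pi>1 Y i))"

end

theory Submission
  imports Defs "HOL-Computational_Algebra.Polynomial"
begin

text \<open>
  At a stationary point the boundary momentum given by Hamilton's equations is
  \<open>\<pi>\<^sup>0\<^sub>1\<^sub>[\<^sub>\<alpha>\<^sub>] - \<Delta>t \<Sum>\<^sub>k s\<^sub>k X\<^sup>k\<^sup>\<alpha>\<close> with \<open>s\<^sub>k = \<Sum>\<^sub>j\<^sub>l b\<^sub>j a'\<^sub>j\<^sub>k (a\<^sup>-\<^sup>1)\<^sub>j\<^sub>l\<close>, whatever \<open>H\<close> is. It agrees with the
  expansion \<open>\<pi>\<^sup>0\<^sub>1\<^sub>[\<^sub>\<alpha>\<^sub>] - \<Delta>t \<Sum>\<^sub>k b'\<^sub>k X\<^sup>k\<^sup>\<alpha>\<close> for all \<open>X\<close> iff \<open>s = b'\<close>, and enough values of \<open>X\<close> and \<open>Y\<close>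
  do occur at stationary points, for suitable Hamiltonians that are affine in the momenta.
\<close>

section \<open>Smoothness of elementary functions\<close>

text \<open>\<open>C_diff\<close> records continuity only at the last level; at the bottom it is
  recovered from differentiability. The product rule needs this, since it mixes derivatives with
  undifferentiated factors.\<close>

lemma C_diff_Suc_imp: "C_diff (Suc n) f \<Longrightarrow> C_diff n f"
proof (induction n arbitrary: f)
  case 0
  then show ?case
    by (auto simp: continuous_on_eq_continuous_at intro: differentiable_imp_continuous_within)
next
  case (Suc n)
  then show ?case by auto
qed

lemma C_diff_const: "C_diff n (\<lambda>x. c)"
  by (induction n arbitrary: c) auto

text \<open>The derivative is the map itself at every point, so each directional derivative is
  constant.\<close>

lemma C_diff_bounded_linear:
  assumes "bounded_linear f"
  shows "C_diff n f"
proof (cases n)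
  case 0
  then show ?thesis using assms by (simp add: linear_continuous_on)
next
  case (Suc m)
  have D: "(f has_derivative f) (at x)" for x
    using assms by (rule bounded_linear_imp_has_derivative)
  then have "frechet_derivative f (at x) = f" for x
    by (metis frechet_derivative_at)
  with D Suc show ?thesis by (auto simp: differentiable_def C_diff_const)
qed

lemma C_diff_add: "C_diff n f \<Longrightarrow> C_diff n g \<Longrightarrow> C_diff n (\<lambda>x. f x + g x)"
proof (induction n arbitrary: f g)
  case 0
  then show ?case by (auto intro: continuous_on_add)
next
  case (Suc n)
  have "frechet_derivative (\<lambda>x. f x + g x) (at x)
      = (\<lambda>v. frechet_derivative f (at x) v + frechet_derivative g (at x) v)" for x
    using Suc.prems
    by (intro frechet_derivative_at[symmetric] has_derivative_add)
      (simp_all add: frechet_derivative_works)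
  with Suc show ?case by auto
qed

lemma C_diff_mult:
  fixes f g :: "'a::real_normed_vector \<Rightarrow> real"
  shows "C_diff n f \<Longrightarrow> C_diff n g \<Longrightarrow> C_diff n (\<lambda>x. f x * g x)"
proof (induction n arbitrary: f g)
  case 0
  then show ?case by (auto intro: continuous_on_mult)
next
  case (Suc n)
  have "frechet_derivative (\<lambda>x. f x * g x) (at x)
      = (\<lambda>v. f x * frechet_derivative g (at x) v + frechet_derivative f (at x) v * g x)" for x
    using Suc.prems
    by (intro frechet_derivative_at[symmetric] has_derivative_mult)
      (simp_all add: frechet_derivative_works)
  \<comment> \<open>The factors \<open>f\<close> and \<open>g\<close> reappear beside their
    derivatives, so they too are needed at class \<open>n\<close>.\<close>
  with Suc C_diff_Suc_imp[OF Suc.prems(1)] C_diff_Suc_imp[OF Suc.prems(2)] show ?case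
    by (auto intro!: C_diff_add Suc.IH)
qed

lemma smooth_const: "smooth (\<lambda>x. c)"
  by (simp add: smooth_def C_diff_const)

lemma smooth_bounded_linear: "bounded_linear f \<Longrightarrow> smooth f"
  by (simp add: smooth_def C_diff_bounded_linear)

lemma smooth_add: "smooth f \<Longrightarrow> smooth g \<Longrightarrow> smooth (\<lambda>x. f x + g x)"
  by (simp add: smooth_def C_diff_add)

lemma smooth_mult:
  fixes f g :: "'a::real_normed_vector \<Rightarrow> real"
  shows "smooth f \<Longrightarrow> smooth g \<Longrightarrow> smooth (\<lambda>x. f x * g x)"
  by (simp add: smooth_def C_diff_mult)

lemma smooth_poly:
  fixes f :: "'a::real_normed_vector \<Rightarrow> real"
  assumes "smooth f"
  shows "smooth (\<lambda>x. poly p (f x))"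
  by (induction p) (simp_all add: smooth_const smooth_add smooth_mult assms)

lemma smooth_has_derivative:
  "smooth f \<Longrightarrow> (f has_derivative frechet_derivative f (at x)) (at x)"
  by (metis C_diff.simps(2) frechet_derivative_works smooth_def)

section \<open>The derivative of the discrete action\<close>

text \<open>The joint differential of \<open>K\<close> in the boundary fields (directions
  \<open>v0\<close>, \<open>v1\<close>) and the internal variables (primed), with boundary momenta
  fixed. The stages are affine, so their variations are the same expansions with 0 in place of the
  boundary momenta. \<open>D i \<alpha>\<close> stands for the derivative of \<open>H\<close> at the
  stage \<open>(i, \<alpha>)\<close>.\<close>

definition K_deriv where
  "K_deriv dt dx \<theta> T S D \<phi>0 \<phi>1 \<pi>0 \<pi>1 = (\<lambda>(V, W, X, Y, lam) v0 v1 (V', W', X', Y', lam').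
     let \<Phi> = \<Phi>_time dt T \<phi>0 V; \<Phi>' = \<Phi>_space dx S \<phi>1 W;
         P0 = P_time dt T \<pi>0 X; P1 = P_space dx S \<pi>1 Y;
         d\<Phi> = \<Phi>_time dt T v0 V'; d\<Phi>' = \<Phi>_space dx S v1 W';
         dP0 = P_time dt T 0 X'; dP1 = P_space dx S 0 Y'
     in dx * (\<Sum>\<alpha>\<in>UNIV. rk_b S \<alpha> *
               blinfun_apply (\<pi>0 $ \<alpha>) (v0 $ \<alpha> + dt *\<^sub>R (\<Sum>j\<in>UNIV. rk_b T j *\<^sub>R V' $ j $ \<alpha>)))
      + dt * (\<Sum>i\<in>UNIV. rk_b T i *
               blinfun_apply (\<pi>1 $ i) (v1 $ i + dx *\<^sub>R (\<Sum>\<beta>\<in>UNIV. rk_b S \<beta> *\<^sub>R W' $ i $ \<beta>)))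
      - dt * dx * (\<Sum>i\<in>UNIV. \<Sum>\<alpha>\<in>UNIV. rk_b T i * rk_b S \<alpha> *
               (blinfun_apply (P0 i \<alpha>) (V' $ i $ \<alpha>) + blinfun_apply (dP0 i \<alpha>) (V $ i $ \<alpha>)))
      - dt * dx * (\<Sum>i\<in>UNIV. \<Sum>\<alpha>\<in>UNIV. rk_b T i * rk_b S \<alpha> *
               (blinfun_apply (P1 i \<alpha>) (W' $ i $ \<alpha>) + blinfun_apply (dP1 i \<alpha>) (W $ i $ \<alpha>)))
      + dt * dx * (\<Sum>i\<in>UNIV. \<Sum>\<alpha>\<in>UNIV. rk_b T i * rk_b S \<alpha> *
               D i \<alpha> (\<theta> *\<^sub>R d\<Phi> i \<alpha> + (1 - \<theta>) *\<^sub>R d\<Phi>' i \<alpha>, dP0 i \<alpha>, dP1 i \<alpha>))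
      + (\<Sum>i\<in>UNIV. \<Sum>\<alpha>\<in>UNIV. blinfun_apply (lam $ i $ \<alpha>) (d\<Phi> i \<alpha> - d\<Phi>' i \<alpha>)
             + blinfun_apply (lam' $ i $ \<alpha>) (\<Phi> i \<alpha> - \<Phi>' i \<alpha>)))"

lemma has_derivative_vec_nth:
  "(f has_derivative f') F \<Longrightarrow> ((\<lambda>x. f x $ i) has_derivative (\<lambda>h. f' h $ i)) F"
  by (rule bounded_linear.has_derivative[OF bounded_linear_vec_nth])

text \<open>Every argument of \<open>K\<close> is a differentiable function of one common variable,
  so that the differentiation rules apply term by term; the joint derivative follows by taking these
  functions to be projections.\<close>

lemma has_derivative_K_compose:
  fixes u :: "'a::real_normed_vector \<Rightarrow> 'q::euclidean_space^'r::finite"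
    and v :: "'a \<Rightarrow> 'q^'s::finite"
  assumes d: "(u has_derivative u') (at x)" "(v has_derivative v') (at x)"
    "(V has_derivative V') (at x)" "(W has_derivative W') (at x)"
    "(X has_derivative X') (at x)" "(Y has_derivative Y') (at x)"
    "(lam has_derivative lam') (at x)"
    and H: "\<And>i \<alpha>. (H has_derivative D i \<alpha>)
      (at (\<theta> *\<^sub>R \<Phi>_time dt T (u x) (V x) i \<alpha> + (1 - \<theta>) *\<^sub>R \<Phi>_space dx S (v x) (W x) i \<alpha>,
           P_time dt T \<pi>0 (X x) i \<alpha>, P_space dx S \<pi>1 (Y x) i \<alpha>))"
  shows "((\<lambda>x. K dt dx \<theta> T S H (u x) (v x) \<pi>0 \<pi>1 (V x, W x, X x, Y x, lam x)) has_derivative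
     (\<lambda>h. K_deriv dt dx \<theta> T S D (u x) (v x) \<pi>0 \<pi>1 (V x, W x, X x, Y x, lam x)
            (u' h) (v' h) (V' h, W' h, X' h, Y' h, lam' h))) (at x)"
proof -
  note [derivative_intros] = d[THEN has_derivative_vec_nth]
    d(3-)[THEN has_derivative_vec_nth, THEN has_derivative_vec_nth]
  have [derivative_intros]:
    "((\<lambda>x. \<Phi>_time dt T (u x) (V x) i \<alpha>) has_derivative (\<lambda>h. \<Phi>_time dt T (u' h) (V' h) i \<alpha>)) (at x)"
    "((\<lambda>x. \<Phi>_space dx S (v x) (W x) i \<alpha>) has_derivative (\<lambda>h. \<Phi>_space dx S (v' h) (W' h) i \<alpha>)) (at x)"
    "((\<lambda>x. P_time dt T \<pi>0 (X x) i \<alpha>) has_derivative (\<lambda>h. P_time dt T 0 (X' h) i \<alpha>)) (at x)"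
    "((\<lambda>x. P_space dx S \<pi>1 (Y x) i \<alpha>) has_derivative (\<lambda>h. P_space dx S 0 (Y' h) i \<alpha>)) (at x)"
    for i \<alpha>
    unfolding \<Phi>_time_def \<Phi>_space_def P_time_def P_space_def
    by (auto intro!: derivative_eq_intros)
  have stages: "((\<lambda>x. (\<theta> *\<^sub>R \<Phi>_time dt T (u x) (V x) i \<alpha> + (1 - \<theta>) *\<^sub>R \<Phi>_space dx S (v x) (W x) i \<alpha>,
           P_time dt T \<pi>0 (X x) i \<alpha>, P_space dx S \<pi>1 (Y x) i \<alpha>)) has_derivative
      (\<lambda>h. (\<theta> *\<^sub>R \<Phi>_time dt T (u' h) (V' h) i \<alpha> + (1 - \<theta>) *\<^sub>R \<Phi>_space dx S (v' h) (W' h) i \<alpha>,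
           P_time dt T 0 (X' h) i \<alpha>, P_space dx S 0 (Y' h) i \<alpha>))) (at x)" for i \<alpha>
    by (auto intro!: derivative_eq_intros)
  note [derivative_intros] = has_derivative_compose[OF stages H]
  show ?thesis
    unfolding K_def K_deriv_def Let_def prod.case
    by (rule derivative_eq_intros refl ext | simp add: algebra_simps)+
qed

lemma has_derivative_K:
  fixes V :: "'q::euclidean_space^'r::finite^'s::finite"
  assumes "\<And>i \<alpha>. (H has_derivative D i \<alpha>)
      (at (\<theta> *\<^sub>R \<Phi>_time dt T \<phi>0 V i \<alpha> + (1 - \<theta>) *\<^sub>R \<Phi>_space dx S \<phi>1 W i \<alpha>,
           P_time dt T \<pi>0 X i \<alpha>, P_space dx S \<pi>1 Y i \<alpha>))"
  shows "((\<lambda>(u, v, z). K dt dx \<theta> T S H u v \<pi>0 \<pi>1 z) has_derivative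
      (\<lambda>(u, v, z). K_deriv dt dx \<theta> T S D \<phi>0 \<phi>1 \<pi>0 \<pi>1 (V, W, X, Y, lam) u v z))
      (at (\<phi>0, \<phi>1, V, W, X, Y, lam))"
proof -
  let ?p = "(\<phi>0, \<phi>1, V, W, X, Y, lam)"
  have "((\<lambda>p. K dt dx \<theta> T S H (fst p) (fst (snd p)) \<pi>0 \<pi>1
        (fst (snd (snd p)), fst (snd (snd (snd p))), fst (snd (snd (snd (snd p)))),
         fst (snd (snd (snd (snd (snd p))))), snd (snd (snd (snd (snd (snd p)))))))
      has_derivative (\<lambda>h. K_deriv dt dx \<theta> T S D (fst ?p) (fst (snd ?p)) \<pi>0 \<pi>1
        (fst (snd (snd ?p)), fst (snd (snd (snd ?p))), fst (snd (snd (snd (snd ?p)))),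
         fst (snd (snd (snd (snd (snd ?p))))), snd (snd (snd (snd (snd (snd ?p))))))
        (fst h) (fst (snd h))
        (fst (snd (snd h)), fst (snd (snd (snd h))), fst (snd (snd (snd (snd h)))),
         fst (snd (snd (snd (snd (snd h))))), snd (snd (snd (snd (snd (snd h)))))))) (at ?p)"
    by (rule has_derivative_K_compose) (auto intro!: derivative_eq_intros assms)
  then show ?thesis by (simp add: case_prod_unfold)
qed

text \<open>The joint differential is linear and, by stationarity, vanishes in purely internal
  directions. Hence any internal variation may be added to a boundary variation without changing the
  derivative.\<close>

lemma stationary_K_deriv:
  fixes V :: "'q::euclidean_space^'r::finite^'s::finite"
  assumes H: "smooth H"
    and stat: "stationary_point (K dt dx \<theta> T S H \<phi>0 \<phi>1 \<pi>0 \<pi>1) (V, W, X, Y, lam)"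
  obtains D where "\<And>i \<alpha>. D i \<alpha> 0 = 0"
    and "((\<lambda>(u, v, z). K dt dx \<theta> T S H u v \<pi>0 \<pi>1 z) has_derivative
      (\<lambda>(u, v, z). K_deriv dt dx \<theta> T S D \<phi>0 \<phi>1 \<pi>0 \<pi>1 (V, W, X, Y, lam) u v z))
      (at (\<phi>0, \<phi>1, V, W, X, Y, lam))"
    and "\<And>u v z. K_deriv dt dx \<theta> T S D \<phi>0 \<phi>1 \<pi>0 \<pi>1 (V, W, X, Y, lam) u v 0
      = K_deriv dt dx \<theta> T S D \<phi>0 \<phi>1 \<pi>0 \<pi>1 (V, W, X, Y, lam) u v z"
proof -
  define D where "D i \<alpha> = frechet_derivative H
      (at (\<theta> *\<^sub>R \<Phi>_time dt T \<phi>0 V i \<alpha> + (1 - \<theta>) *\<^sub>R \<Phi>_space dx S \<phi>1 W i \<alpha>,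
           P_time dt T \<pi>0 X i \<alpha>, P_space dx S \<pi>1 Y i \<alpha>))" for i \<alpha>
  have D0: "D i \<alpha> 0 = 0" for i \<alpha>
    unfolding D_def by (rule linear_0[OF has_derivative_linear[OF smooth_has_derivative[OF H]]])
  define L where "L u v z = K_deriv dt dx \<theta> T S D \<phi>0 \<phi>1 \<pi>0 \<pi>1 (V, W, X, Y, lam) u v z"
    for u v z
  have D: "((\<lambda>(u, v, z). K dt dx \<theta> T S H u v \<pi>0 \<pi>1 z) has_derivative (\<lambda>(u, v, z). L u v z))
      (at (\<phi>0, \<phi>1, V, W, X, Y, lam))"
    unfolding L_def by (rule has_derivative_K) (unfold D_def, rule smooth_has_derivative[OF H])
  have "((\<lambda>z. (\<phi>0, \<phi>1, z)) has_derivative (\<lambda>z. (0, 0, z))) (at (V, W, X, Y, lam))"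
    by (auto intro!: derivative_eq_intros)
  from has_derivative_compose[OF this D]
  have "((\<lambda>z. K dt dx \<theta> T S H \<phi>0 \<phi>1 \<pi>0 \<pi>1 z) has_derivative (\<lambda>z. L 0 0 z)) (at (V, W, X, Y, lam))"
    by simp
  from has_derivative_unique[OF this stat[unfolded stationary_point_def]]
  have L0: "L 0 0 z = 0" for z
    by (rule fun_cong)
  have "L u v 0 = L u v z" for u v z
    using linear_add[OF has_derivative_linear[OF D], of "(u, v, 0)" "(0, 0, z)"] L0 by simp
  with D0 D show thesis
    unfolding L_def by (rule that)
qed

lemma bounded_linear_axis: "bounded_linear (axis i :: 'q::euclidean_space \<Rightarrow> 'q^'n)"
  by (auto simp: linear_conv_bounded_linear[symmetric] vec_eq_iff axis_def intro!: linearI)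

section \<open>Linear systems and the symplecticity condition\<close>

lemma matrix_inv_right_sum:
  fixes A :: "'a::field^'n^'n"
  assumes "invertible A"
  shows "(\<Sum>l\<in>UNIV. A $ i $ l * matrix_inv A $ l $ k) = (if i = k then 1 else 0)"
proof -
  have "A ** matrix_inv A = mat 1"
    using assms unfolding invertible_def matrix_inv_def by (rule someI2_ex) simp
  then have "(A ** matrix_inv A) $ i $ k = mat 1 $ i $ k" by simp
  then show ?thesis by (simp add: matrix_matrix_mult_def mat_def)
qed

lemma matrix_inv_left_sum:
  fixes A :: "'a::field^'n^'n"
  assumes "invertible A"
  shows "(\<Sum>l\<in>UNIV. matrix_inv A $ i $ l * A $ l $ k) = (if i = k then 1 else 0)"
proof -
  have "matrix_inv A ** A = mat 1"
    using assms unfolding invertible_def matrix_inv_def by (rule someI2_ex) simp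
  then have "(matrix_inv A ** A) $ i $ k = mat 1 $ i $ k" by simp
  then show ?thesis by (simp add: matrix_matrix_mult_def mat_def)
qed

text \<open>The index \<open>a\<close> allows a whole family of right-hand sides: a system in one
  direction is solved for each index of the other direction. The witness is the inverse matrix
  applied to \<open>c a\<close>.\<close>

lemma invertible_solve:
  fixes A :: "'a::field^'n^'n"
  assumes "invertible A"
  obtains v where "\<And>a i. (\<Sum>j\<in>UNIV. A $ i $ j * v a j) = c a i"
proof
  fix a i
  have "(\<Sum>j\<in>UNIV. A $ i $ j * (\<Sum>l\<in>UNIV. matrix_inv A $ j $ l * c a l))
      = (\<Sum>l\<in>UNIV. (\<Sum>j\<in>UNIV. A $ i $ j * matrix_inv A $ j $ l) * c a l)"
    unfolding sum_distrib_left sum_distrib_right by (subst sum.swap) (simp add: mult.assoc)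
  then show "(\<Sum>j\<in>UNIV. A $ i $ j * (\<Sum>l\<in>UNIV. matrix_inv A $ j $ l * c a l)) = c a i"
    by (simp add: matrix_inv_right_sum[OF assms] if_distrib[of "\<lambda>x. x * _"] cong: if_cong)
qed

lemma invertible_solve_transpose:
  fixes A :: "'a::field^'n^'n"
  assumes "invertible A"
  obtains m where "\<And>a j. (\<Sum>i\<in>UNIV. m a i * A $ i $ j) = c a j"
proof
  fix a k
  have "(\<Sum>i\<in>UNIV. (\<Sum>j\<in>UNIV. c a j * matrix_inv A $ j $ i) * A $ i $ k)
      = (\<Sum>j\<in>UNIV. c a j * (\<Sum>i\<in>UNIV. matrix_inv A $ j $ i * A $ i $ k))"
    unfolding sum_distrib_left sum_distrib_right by (subst sum.swap) (simp add: mult.assoc)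
  then show "(\<Sum>i\<in>UNIV. (\<Sum>j\<in>UNIV. c a j * matrix_inv A $ j $ i) * A $ i $ k) = c a k"
    by (simp add: matrix_inv_left_sum[OF assms] if_distrib[of "\<lambda>x. _ * x"] cong: if_cong)
qed

text \<open>The left-hand side of the symplecticity condition. The inverse matrix enters only
  through its row sums \<open>r j\<close>, the solution of \<open>a r = 1\<close>, so the value is
  the sum over \<open>j\<close> of \<open>b j * r j * a' j k\<close>.\<close>

definition transported_weight :: "'n::finite prk \<Rightarrow> 'n \<Rightarrow> real" where
  "transported_weight T k =
     (\<Sum>j\<in>UNIV. \<Sum>l\<in>UNIV. rk_b T j * mom_A T $ j $ k * matrix_inv (rk_A T) $ j $ l)"

lemma symplectic_iff_transported_weight:
  "symplectic T \<longleftrightarrow> (\<forall>k. transported_weight T k = mom_b T k)"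
  by (simp add: symplectic_def transported_weight_def)

text \<open>The factor \<open>b j\<close> cancels, and the remaining product of \<open>a\<close>
  with its inverse has row sums 1, leaving \<open>b' k\<close>.\<close>

lemma usual_symplectic_choice_imp_symplectic:
  assumes "usual_symplectic_choice T" "\<And>i. rk_b T i \<noteq> 0" "invertible (rk_A T)"
  shows "symplectic T"
  unfolding symplectic_iff_transported_weight
proof
  fix k
  have "transported_weight T k
      = (\<Sum>j\<in>UNIV. \<Sum>l\<in>UNIV. mom_b T k * (rk_A T $ k $ j * matrix_inv (rk_A T) $ j $ l))"
    unfolding transported_weight_def using assms(1,2)
    by (intro sum.cong refl) (simp add: usual_symplectic_choice_def)
  also have "\<dots> = mom_b T k * (\<Sum>l\<in>UNIV. \<Sum>j\<in>UNIV. rk_A T $ k $ j * matrix_inv (rk_A T) $ j $ l)"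
    by (subst sum.swap) (simp add: sum_distrib_left)
  finally show "transported_weight T k = mom_b T k"
    by (simp add: matrix_inv_right_sum[OF assms(3)])
qed

section \<open>Boundary momenta at a stationary point\<close>

text \<open>
  Moving \<open>\<phi>0 $ \<alpha>\<close> by \<open>q\<close> and all \<open>V $ j $ \<alpha>\<close> by \<open>- (r\<^sub>j / dt) *\<^sub>R q\<close>, where \<open>r\<close> solves
  \<open>a r = 1\<close>, leaves every stage unchanged, so the contributions of \<open>H\<close> and \<open>\<lambda>\<close> drop out.
\<close>

lemma hamilton_momentum_time_eq:
  fixes V :: "'q::euclidean_space^'r::finite^'s::finite"
  assumes H: "smooth H" and "dt \<noteq> 0" "dx \<noteq> 0" "rk_b S \<alpha> \<noteq> 0" and inv: "invertible (rk_A T)"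
    and stat: "stationary_point (K dt dx \<theta> T S H \<phi>0 \<phi>1 \<pi>0 \<pi>1) (V, W, X, Y, lam)"
  shows "hamilton_momentum_time dt dx \<theta> T S H \<phi>0 \<phi>1 \<pi>0 \<pi>1 (V, W, X, Y, lam) \<alpha>
    = \<pi>0 $ \<alpha> - dt *\<^sub>R (\<Sum>k\<in>UNIV. transported_weight T k *\<^sub>R X $ k $ \<alpha>)"
proof -
  obtain D where D0: "\<And>i \<beta>. D i \<beta> 0 = 0"
    and D: "((\<lambda>(u, v, z). K dt dx \<theta> T S H u v \<pi>0 \<pi>1 z) has_derivative
      (\<lambda>(u, v, z). K_deriv dt dx \<theta> T S D \<phi>0 \<phi>1 \<pi>0 \<pi>1 (V, W, X, Y, lam) u v z))
      (at (\<phi>0, \<phi>1, V, W, X, Y, lam))"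
    and stat_eq: "\<And>u v z. K_deriv dt dx \<theta> T S D \<phi>0 \<phi>1 \<pi>0 \<pi>1 (V, W, X, Y, lam) u v 0
      = K_deriv dt dx \<theta> T S D \<phi>0 \<phi>1 \<pi>0 \<pi>1 (V, W, X, Y, lam) u v z"
    using stationary_K_deriv[OF H stat] by blast
  define L where "L u v z = K_deriv dt dx \<theta> T S D \<phi>0 \<phi>1 \<pi>0 \<pi>1 (V, W, X, Y, lam) u v z"
    for u v z
  note D = D[folded L_def] and stat_eq = stat_eq[folded L_def]
  \<comment> \<open>Overwriting one component is a translation along \<open>axis \<alpha>\<close>,
    hence affine in \<open>q\<close>, and the chain rule applies.\<close>
  have upd: "(\<chi> \<beta>. if \<beta> = \<alpha> then q else \<phi>0 $ \<beta>) = \<phi>0 + axis \<alpha> (q - \<phi>0 $ \<alpha>)" for q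
    by (simp add: vec_eq_iff axis_def)
  have "((\<lambda>q. (\<phi>0 + axis \<alpha> (q - \<phi>0 $ \<alpha>), \<phi>1, V, W, X, Y, lam)) has_derivative
      (\<lambda>q. (axis \<alpha> q, 0, 0))) (at (\<phi>0 $ \<alpha>))"
    by (auto intro!: derivative_eq_intros bounded_linear.has_derivative[OF bounded_linear_axis]
        simp: zero_prod_def)
  from has_derivative_compose[OF this, of "\<lambda>(u, v, z). K dt dx \<theta> T S H u v \<pi>0 \<pi>1 z"
      "\<lambda>(u, v, z). L u v z"] D
  have "((\<lambda>q. K dt dx \<theta> T S H (\<phi>0 + axis \<alpha> (q - \<phi>0 $ \<alpha>)) \<phi>1 \<pi>0 \<pi>1 (V, W, X, Y, lam))
      has_derivative (\<lambda>q. L (axis \<alpha> q) 0 0)) (at (\<phi>0 $ \<alpha>))"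
    by (simp add: linear_0[OF bounded_linear.linear[OF bounded_linear_axis]])
  \<comment> \<open>\<open>Blinfun\<close> can be undone only on bounded linear maps; boundedness
    comes with the derivative.\<close>
  then have dual: "blinfun_apply (dual_derivative
      (\<lambda>q. K dt dx \<theta> T S H (\<chi> \<beta>. if \<beta> = \<alpha> then q else \<phi>0 $ \<beta>) \<phi>1 \<pi>0 \<pi>1 (V, W, X, Y, lam))
      (\<phi>0 $ \<alpha>)) q = L (axis \<alpha> q) 0 0" for q
    unfolding upd dual_derivative_def
    by (metis bounded_linear_Blinfun_apply frechet_derivative_at has_derivative_bounded_linear)
  define r where "r j = (\<Sum>l\<in>UNIV. matrix_inv (rk_A T) $ j $ l)" for j
  have r: "(\<Sum>j\<in>UNIV. rk_A T $ i $ j * r j) = 1" for i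
    unfolding r_def sum_distrib_left
    by (subst sum.swap) (simp add: matrix_inv_right_sum[OF inv])
  show ?thesis
  proof (rule blinfun_eqI)
    fix q
    define Z :: "'q^'r^'s" where "Z = (\<chi> j. axis \<alpha> (- (r j / dt) *\<^sub>R q))"
    have Z: "Z $ j $ \<beta> = (if \<beta> = \<alpha> then - (r j / dt) *\<^sub>R q else 0)" for j \<beta>
      by (simp add: Z_def axis_def)
    have st: "\<Phi>_time dt T (axis \<alpha> q) Z i \<beta> = 0" for i \<beta>
      using \<open>dt \<noteq> 0\<close> r[of i]
      by (simp add: \<Phi>_time_def Z axis_def sum_negf scaleR_sum_left[symmetric]
          sum_divide_distrib[symmetric])
    have st': "\<Phi>_space dx S 0 0 i \<beta> = 0" "P_time dt T 0 0 i \<beta> = 0" "P_space dx S 0 0 i \<beta> = 0"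
      for i :: 's and \<beta>
      by (simp_all add: \<Phi>_space_def P_time_def P_space_def)
    have D0': "D i \<beta> (0, 0, 0) = 0" for i \<beta>
      using D0 by (simp add: zero_prod_def)
    have t1: "rk_b S \<beta> * blinfun_apply (\<pi>0 $ \<beta>)
          (axis \<alpha> q $ \<beta> + dt *\<^sub>R (\<Sum>j\<in>UNIV. rk_b T j *\<^sub>R Z $ j $ \<beta>))
        = (if \<beta> = \<alpha> then rk_b S \<alpha> * ((1 - (\<Sum>i\<in>UNIV. rk_b T i * r i)) * blinfun_apply (\<pi>0 $ \<alpha>) q)
           else 0)" for \<beta>
      using \<open>dt \<noteq> 0\<close>
      by (simp add: Z axis_def sum_negf scaleR_sum_left[symmetric] sum_divide_distrib[symmetric]
          blinfun.bilinear_simps algebra_simps sum_distrib_left)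
    have t2: "rk_b T i * rk_b S \<beta> * (blinfun_apply p (Z $ i $ \<beta>) + 0)
        = (if \<beta> = \<alpha> then - (rk_b T i * rk_b S \<alpha> * r i / dt) * blinfun_apply p q else 0)" for i \<beta> p
      by (simp add: Z blinfun.bilinear_simps)
    \<comment> \<open>Stationarity permits adding the compensating direction \<open>Z\<close> in the
      \<open>V\<close> slot.\<close>
    have "L (axis \<alpha> q) 0 0 = L (axis \<alpha> q) 0 (Z, 0, 0, 0, 0)"
      by (rule stat_eq)
    also have "\<dots> = dx * (rk_b S \<alpha> * ((1 - (\<Sum>i\<in>UNIV. rk_b T i * r i)) * blinfun_apply (\<pi>0 $ \<alpha>) q))
        - dt * dx * (\<Sum>i\<in>UNIV. - (rk_b T i * rk_b S \<alpha> * r i / dt)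
            * blinfun_apply (P_time dt T \<pi>0 X i \<alpha>) q)"
      by (simp add: L_def K_deriv_def st st' D0' t1 t2[unfolded add_0_right])
    \<comment> \<open>Each stage momentum contains a copy of \<open>\<pi>0 $ \<alpha>\<close>. These
      copies add up to the sum of \<open>b i * r i\<close> that the boundary term lacks, so
      \<open>\<pi>0 $ \<alpha>\<close> survives with coefficient 1.\<close>
    also have "\<dots> = rk_b S \<alpha> * dx * (blinfun_apply (\<pi>0 $ \<alpha>) q
        - dt * (\<Sum>i\<in>UNIV. rk_b T i * r i * (\<Sum>k\<in>UNIV. mom_A T $ i $ k * blinfun_apply (X $ k $ \<alpha>) q)))"
      using \<open>dt \<noteq> 0\<close>
      by (simp add: P_time_def blinfun.bilinear_simps blinfun.sum_left sum_distrib_left sum_distrib_right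
          sum_subtractf sum_negf algebra_simps)
    also have "(\<Sum>i\<in>UNIV. rk_b T i * r i * (\<Sum>k\<in>UNIV. mom_A T $ i $ k * blinfun_apply (X $ k $ \<alpha>) q))
        = (\<Sum>k\<in>UNIV. transported_weight T k * blinfun_apply (X $ k $ \<alpha>) q)"
      unfolding transported_weight_def r_def sum_distrib_left sum_distrib_right
      by (subst sum.swap) (simp add: ac_simps)
    finally show "blinfun_apply (hamilton_momentum_time dt dx \<theta> T S H \<phi>0 \<phi>1 \<pi>0 \<pi>1 (V, W, X, Y, lam) \<alpha>) q
      = blinfun_apply (\<pi>0 $ \<alpha> - dt *\<^sub>R (\<Sum>k\<in>UNIV. transported_weight T k *\<^sub>R X $ k $ \<alpha>)) q"
      using assms(2-4)
      by (simp add: hamilton_momentum_time_def dual blinfun.bilinear_simps blinfun.sum_left)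
  qed
qed

text \<open>The mirror image in space: \<open>\<phi>1 $ i\<close> moves by \<open>q\<close> and each
  \<open>W $ i $ \<beta>\<close> by \<open>- (r \<beta> / dx) *\<^sub>R q\<close>, with
  \<open>r\<close> the row sums of the inverse spatial matrix.\<close>

lemma hamilton_momentum_space_eq:
  fixes V :: "'q::euclidean_space^'r::finite^'s::finite"
  assumes H: "smooth H" and "dt \<noteq> 0" "dx \<noteq> 0" "rk_b T i \<noteq> 0" and inv: "invertible (rk_A S)"
    and stat: "stationary_point (K dt dx \<theta> T S H \<phi>0 \<phi>1 \<pi>0 \<pi>1) (V, W, X, Y, lam)"
  shows "hamilton_momentum_space dt dx \<theta> T S H \<phi>0 \<phi>1 \<pi>0 \<pi>1 (V, W, X, Y, lam) i
    = \<pi>1 $ i - dx *\<^sub>R (\<Sum>\<beta>\<in>UNIV. transported_weight S \<beta> *\<^sub>R Y $ i $ \<beta>)"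
proof -
  obtain D where D0: "\<And>i \<beta>. D i \<beta> 0 = 0"
    and D: "((\<lambda>(u, v, z). K dt dx \<theta> T S H u v \<pi>0 \<pi>1 z) has_derivative
      (\<lambda>(u, v, z). K_deriv dt dx \<theta> T S D \<phi>0 \<phi>1 \<pi>0 \<pi>1 (V, W, X, Y, lam) u v z))
      (at (\<phi>0, \<phi>1, V, W, X, Y, lam))"
    and stat_eq: "\<And>u v z. K_deriv dt dx \<theta> T S D \<phi>0 \<phi>1 \<pi>0 \<pi>1 (V, W, X, Y, lam) u v 0
      = K_deriv dt dx \<theta> T S D \<phi>0 \<phi>1 \<pi>0 \<pi>1 (V, W, X, Y, lam) u v z"
    using stationary_K_deriv[OF H stat] by blast
  define L where "L u v z = K_deriv dt dx \<theta> T S D \<phi>0 \<phi>1 \<pi>0 \<pi>1 (V, W, X, Y, lam) u v z"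
    for u v z
  note D = D[folded L_def] and stat_eq = stat_eq[folded L_def]
  have upd: "(\<chi> j. if j = i then q else \<phi>1 $ j) = \<phi>1 + axis i (q - \<phi>1 $ i)" for q
    by (simp add: vec_eq_iff axis_def)
  have "((\<lambda>q. (\<phi>0, \<phi>1 + axis i (q - \<phi>1 $ i), V, W, X, Y, lam)) has_derivative
      (\<lambda>q. (0, axis i q, 0))) (at (\<phi>1 $ i))"
    by (auto intro!: derivative_eq_intros bounded_linear.has_derivative[OF bounded_linear_axis]
        simp: zero_prod_def)
  from has_derivative_compose[OF this, of "\<lambda>(u, v, z). K dt dx \<theta> T S H u v \<pi>0 \<pi>1 z"
      "\<lambda>(u, v, z). L u v z"] D
  have "((\<lambda>q. K dt dx \<theta> T S H \<phi>0 (\<phi>1 + axis i (q - \<phi>1 $ i)) \<pi>0 \<pi>1 (V, W, X, Y, lam))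
      has_derivative (\<lambda>q. L 0 (axis i q) 0)) (at (\<phi>1 $ i))"
    by (simp add: linear_0[OF bounded_linear.linear[OF bounded_linear_axis]])
  then have dual: "blinfun_apply (dual_derivative
      (\<lambda>q. K dt dx \<theta> T S H \<phi>0 (\<chi> j. if j = i then q else \<phi>1 $ j) \<pi>0 \<pi>1 (V, W, X, Y, lam))
      (\<phi>1 $ i)) q = L 0 (axis i q) 0" for q
    unfolding upd dual_derivative_def
    by (metis bounded_linear_Blinfun_apply frechet_derivative_at has_derivative_bounded_linear)
  define r where "r \<beta> = (\<Sum>\<gamma>\<in>UNIV. matrix_inv (rk_A S) $ \<beta> $ \<gamma>)" for \<beta>
  have r: "(\<Sum>\<beta>\<in>UNIV. rk_A S $ \<alpha> $ \<beta> * r \<beta>) = 1" for \<alpha>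
    unfolding r_def sum_distrib_left
    by (subst sum.swap) (simp add: matrix_inv_right_sum[OF inv])
  show ?thesis
  proof (rule blinfun_eqI)
    fix q
    define Z :: "'q^'r^'s" where "Z = axis i (\<chi> \<beta>. - (r \<beta> / dx) *\<^sub>R q)"
    have Z: "Z $ j $ \<beta> = (if j = i then - (r \<beta> / dx) *\<^sub>R q else 0)" for j \<beta>
      by (simp add: Z_def axis_def)
    have st: "\<Phi>_space dx S (axis i q) Z j \<alpha> = 0" for j \<alpha>
      using \<open>dx \<noteq> 0\<close> r[of \<alpha>]
      by (simp add: \<Phi>_space_def Z axis_def sum_negf scaleR_sum_left[symmetric]
          sum_divide_distrib[symmetric])
    have st': "\<Phi>_time dt T 0 0 j \<beta> = 0" "P_time dt T 0 0 j \<beta> = 0" "P_space dx S 0 0 j \<beta> = 0"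
      for j :: 's and \<beta>
      by (simp_all add: \<Phi>_time_def P_time_def P_space_def)
    have D0': "D j \<beta> (0, 0, 0) = 0" for j \<beta>
      using D0 by (simp add: zero_prod_def)
    have t1: "rk_b T j * blinfun_apply (\<pi>1 $ j)
          (axis i q $ j + dx *\<^sub>R (\<Sum>\<beta>\<in>UNIV. rk_b S \<beta> *\<^sub>R Z $ j $ \<beta>))
        = (if j = i then rk_b T i * ((1 - (\<Sum>\<beta>\<in>UNIV. rk_b S \<beta> * r \<beta>)) * blinfun_apply (\<pi>1 $ i) q)
           else 0)" for j
      using \<open>dx \<noteq> 0\<close>
      by (simp add: Z axis_def sum_negf scaleR_sum_left[symmetric] sum_divide_distrib[symmetric]
          blinfun.bilinear_simps algebra_simps sum_distrib_left)
    \<comment> \<open>Here \<open>Z\<close> is supported on the single outer index \<open>i\<close>,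
      so the whole inner sum is kept and the outer one collapses; in the temporal case the inner sum
      collapses.\<close>
    have t2: "(\<Sum>\<beta>\<in>UNIV. rk_b T j * rk_b S \<beta> * blinfun_apply (P \<beta>) (Z $ j $ \<beta>))
        = (if j = i then \<Sum>\<beta>\<in>UNIV. - (rk_b T i * rk_b S \<beta> * r \<beta> / dx) * blinfun_apply (P \<beta>) q
           else 0)" for j P
      by (simp add: Z blinfun.bilinear_simps mult.assoc)
    have "L 0 (axis i q) 0 = L 0 (axis i q) (0, Z, 0, 0, 0)"
      by (rule stat_eq)
    also have "\<dots> = dt * (rk_b T i * ((1 - (\<Sum>\<beta>\<in>UNIV. rk_b S \<beta> * r \<beta>)) * blinfun_apply (\<pi>1 $ i) q))
        - dt * dx * (\<Sum>\<beta>\<in>UNIV. - (rk_b T i * rk_b S \<beta> * r \<beta> / dx)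
            * blinfun_apply (P_space dx S \<pi>1 Y i \<beta>) q)"
      by (simp add: L_def K_deriv_def st st' D0' t1 t2 sum.delta)
    also have "\<dots> = rk_b T i * dt * (blinfun_apply (\<pi>1 $ i) q
        - dx * (\<Sum>\<alpha>\<in>UNIV. rk_b S \<alpha> * r \<alpha> * (\<Sum>\<beta>\<in>UNIV. mom_A S $ \<alpha> $ \<beta> * blinfun_apply (Y $ i $ \<beta>) q)))"
      using \<open>dx \<noteq> 0\<close>
      by (simp add: P_space_def blinfun.bilinear_simps blinfun.sum_left sum_distrib_left sum_distrib_right
          sum_subtractf sum_negf algebra_simps)
    also have "(\<Sum>\<alpha>\<in>UNIV. rk_b S \<alpha> * r \<alpha> * (\<Sum>\<beta>\<in>UNIV. mom_A S $ \<alpha> $ \<beta> * blinfun_apply (Y $ i $ \<beta>) q))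
        = (\<Sum>\<beta>\<in>UNIV. transported_weight S \<beta> * blinfun_apply (Y $ i $ \<beta>) q)"
      unfolding transported_weight_def r_def sum_distrib_left sum_distrib_right
      by (subst sum.swap) (simp add: ac_simps)
    finally show "blinfun_apply (hamilton_momentum_space dt dx \<theta> T S H \<phi>0 \<phi>1 \<pi>0 \<pi>1 (V, W, X, Y, lam) i) q
      = blinfun_apply (\<pi>1 $ i - dx *\<^sub>R (\<Sum>\<beta>\<in>UNIV. transported_weight S \<beta> *\<^sub>R Y $ i $ \<beta>)) q"
      using assms(2-4)
      by (simp add: hamilton_momentum_space_def dual blinfun.bilinear_simps blinfun.sum_left)
  qed
qed

section \<open>Stationary points with prescribed momenta\<close>

text \<open>Induction on the nodes: the square \<open>Q\<close> of the node polynomial vanishes to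
  second order at the old nodes, so adding \<open>L * Q\<close> preserves the data there. The two
  coefficients of the linear factor \<open>L\<close> fix value and slope at the new node.\<close>

lemma hermite_interpolation:
  fixes f g :: "'a::field \<Rightarrow> 'a"
  assumes "finite A"
  shows "\<exists>p. \<forall>x\<in>A. poly p x = f x \<and> poly (pderiv p) x = g x"
  using assms
proof induction
  case empty
  then show ?case by simp
next
  case (insert a A)
  then obtain p where p: "\<And>x. x \<in> A \<Longrightarrow> poly p x = f x \<and> poly (pderiv p) x = g x"
    by blast
  define R where "R = (\<Prod>b\<in>A. [:- b, 1:])"
  define Q where "Q = R * R"
  have R0: "poly R x = 0" if "x \<in> A" for x
    unfolding R_def poly_prod using insert.hyps(1) that by (auto simp: prod_zero_iff)
  have "poly R a \<noteq> 0"
    unfolding R_def poly_prod using insert.hyps by (auto simp: prod_zero_iff)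
  then have Qa: "poly Q a \<noteq> 0" by (simp add: Q_def)
  have Q0: "poly Q x = 0" "poly (pderiv Q) x = 0" if "x \<in> A" for x
    using R0[OF that] by (simp_all add: Q_def pderiv_mult)
  define d where "d = (f a - poly p a) / poly Q a"
  define e where "e = (g a - poly (pderiv p) a - d * poly (pderiv Q) a) / poly Q a"
  \<comment> \<open>This is \<open>d + e * (x - a)\<close>, with value \<open>d\<close> and slope
    \<open>e\<close> at \<open>a\<close>.\<close>
  define L where "L = [:d - e * a, e:]"
  have L: "poly L a = d" "pderiv L = [:e:]"
    by (simp_all add: L_def pderiv_pCons)
  let ?p = "p + L * Q"
  have "poly ?p a = f a" "poly (pderiv ?p) a = g a"
    using Qa by (simp_all add: pderiv_add pderiv_mult L, simp_all add: d_def e_def)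
  moreover have "poly ?p x = f x \<and> poly (pderiv ?p) x = g x" if "x \<in> A" for x
    using p[OF that] Q0[OF that] by (simp add: pderiv_add pderiv_mult)
  ultimately show ?case by blast
qed

lemma has_derivative_poly_compose:
  fixes f :: "'a::real_normed_vector \<Rightarrow> real"
  assumes "(f has_derivative f') (at x)"
  shows "((\<lambda>x. poly p (f x)) has_derivative (\<lambda>h. poly (pderiv p) (f x) * f' h)) (at x)"
  using has_derivative_compose[OF assms has_field_derivative_imp_has_derivative[OF poly_DERIV]] .

text \<open>
  The Hamiltonian \<open>g(u) + p\<^sup>0(e) v(u) + p\<^sup>1(e) w(u)\<close> with \<open>u = \<phi> \<bullet> e\<close>. Pairwise distinct values
  of \<open>u\<close> at the stages let the polynomials \<open>g\<close>, \<open>v\<close>, \<open>w\<close> prescribe all first derivatives of \<open>H\<close>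
  there, so that the stationarity equations can be solved for any \<open>X\<close>, \<open>Y\<close> along \<open>e\<close>.
\<close>

lemma ex_stationary_point:
  fixes e :: "'q::euclidean_space" and x y :: "'s::finite \<Rightarrow> 'r::finite \<Rightarrow> real"
  assumes "dt \<noteq> 0" "dx \<noteq> 0" and bT: "\<And>i. rk_b T i \<noteq> 0" and bS: "\<And>\<alpha>. rk_b S \<alpha> \<noteq> 0"
    and inv: "invertible (rk_A T)" "invertible (rk_A S)" and e: "e \<bullet> e = 1"
  obtains H V W lam where "smooth H"
    and "stationary_point (K dt dx \<theta> T S H 0 0 0 0) (V, W,
      (\<chi> i \<alpha>. x i \<alpha> *\<^sub>R blinfun_inner_left e), (\<chi> i \<alpha>. y i \<alpha> *\<^sub>R blinfun_inner_left e), lam)"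
proof -
  \<comment> \<open>An injective real labelling \<open>f\<close> of the stages. With
    \<open>v\<close> and \<open>w\<close> below, both field expansions give
    \<open>f (i, \<alpha>) *\<^sub>R e\<close>, so the constraint paired with
    \<open>\<lambda>\<close> holds.\<close>
  obtain n where "inj (n :: 's \<times> 'r \<Rightarrow> nat)"
    using finite_imp_inj_to_nat_seg[OF finite] by metis
  define f where "f = (\<lambda>a. real (n a))"
  have f: "inj f"
    using \<open>inj n\<close> by (simp add: f_def inj_def)
  obtain v where v: "\<And>\<alpha> i. (\<Sum>j\<in>UNIV. rk_A T $ i $ j * v \<alpha> j) = f (i, \<alpha>) / dt"
    using invertible_solve[OF inv(1), of "\<lambda>\<alpha> i. f (i, \<alpha>) / dt"] by blast
  obtain w where w: "\<And>i \<alpha>. (\<Sum>\<beta>\<in>UNIV. rk_A S $ \<alpha> $ \<beta> * w i \<beta>) = f (i, \<alpha>) / dx"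
    using invertible_solve[OF inv(2), of "\<lambda>i \<alpha>. f (i, \<alpha>) / dx"] by blast
  define p0 where "p0 i \<alpha> = - dt * (\<Sum>j\<in>UNIV. mom_A T $ i $ j * x j \<alpha>)" for i \<alpha>
  define p1 where "p1 i \<alpha> = - dx * (\<Sum>\<beta>\<in>UNIV. mom_A S $ \<alpha> $ \<beta> * y i \<beta>)" for i \<alpha>
  \<comment> \<open>Put \<open>?c = dt * dx * b i * b \<alpha>\<close>. Stationarity in
    \<open>V\<close> and \<open>W\<close> is a transposed system for
    \<open>M = \<theta> * ?c * h + l\<close> and \<open>N = (1 - \<theta>) * ?c * h - l\<close>,
    where \<open>h\<close> is the slope of \<open>H\<close> in the field and \<open>l\<close> the
    multiplier along \<open>e\<close>. Solving for \<open>h\<close> and \<open>l\<close> gives the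
    two definitions after \<open>N\<close>.\<close>
  obtain M where M: "\<And>\<alpha> j. (\<Sum>i\<in>UNIV. M \<alpha> i * rk_A T $ i $ j) = dx * rk_b T j * rk_b S \<alpha> * p0 j \<alpha>"
    using invertible_solve_transpose[OF inv(1), of "\<lambda>\<alpha> j. dx * rk_b T j * rk_b S \<alpha> * p0 j \<alpha>"] by blast
  obtain N where N: "\<And>i \<beta>. (\<Sum>\<alpha>\<in>UNIV. N i \<alpha> * rk_A S $ \<alpha> $ \<beta>) = dt * rk_b T i * rk_b S \<beta> * p1 i \<beta>"
    using invertible_solve_transpose[OF inv(2), of "\<lambda>i \<beta>. dt * rk_b T i * rk_b S \<beta> * p1 i \<beta>"] by blast
  define h where "h i \<alpha> = (M \<alpha> i + N i \<alpha>) / (dt * dx * rk_b T i * rk_b S \<alpha>)" for i \<alpha>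
  define l where "l i \<alpha> = M \<alpha> i - \<theta> * (M \<alpha> i + N i \<alpha>)" for i \<alpha>
  have interpolate: "\<exists>p. \<forall>i \<alpha>. poly p (f (i, \<alpha>)) = a i \<alpha> \<and> poly (pderiv p) (f (i, \<alpha>)) = b i \<alpha>"
    for a b :: "'s \<Rightarrow> 'r \<Rightarrow> real"
    using hermite_interpolation[of "range f" "\<lambda>t. case_prod a (inv f t)" "\<lambda>t. case_prod b (inv f t)"]
    by (auto simp: f)
  \<comment> \<open>The value 0 of \<open>pg\<close> is a default; its slope \<open>h\<close> is
    what matters. The slopes of \<open>pv\<close> and \<open>pw\<close> are 0, so the field
    derivative of \<open>H\<close> at a stage does not depend on the momenta there.\<close>
  obtain pg where pg: "\<And>i \<alpha>. poly pg (f (i, \<alpha>)) = 0" "\<And>i \<alpha>. poly (pderiv pg) (f (i, \<alpha>)) = h i \<alpha>"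
    using interpolate[of "\<lambda>_ _. 0" h] by blast
  obtain pv where pv: "\<And>i \<alpha>. poly pv (f (i, \<alpha>)) = v \<alpha> i" "\<And>i \<alpha>. poly (pderiv pv) (f (i, \<alpha>)) = 0"
    using interpolate[of "\<lambda>i \<alpha>. v \<alpha> i" "\<lambda>_ _. 0"] by blast
  obtain pw where pw: "\<And>i \<alpha>. poly pw (f (i, \<alpha>)) = w i \<alpha>" "\<And>i \<alpha>. poly (pderiv pw) (f (i, \<alpha>)) = 0"
    using interpolate[of w "\<lambda>_ _. 0"] by blast
  define H :: "'q \<times> 'q dual \<times> 'q dual \<Rightarrow> real" where
    "H = (\<lambda>q. poly pg (fst q \<bullet> e) + blinfun_apply (fst (snd q)) e * poly pv (fst q \<bullet> e)
        + blinfun_apply (snd (snd q)) e * poly pw (fst q \<bullet> e))"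
  have lin: "bounded_linear (\<lambda>q :: 'q \<times> 'q dual \<times> 'q dual. fst q \<bullet> e)"
    "bounded_linear (\<lambda>q :: 'q \<times> 'q dual \<times> 'q dual. blinfun_apply (fst (snd q)) e)"
    "bounded_linear (\<lambda>q :: 'q \<times> 'q dual \<times> 'q dual. blinfun_apply (snd (snd q)) e)"
    by (intro bounded_linear_intros)+
  have smooth: "smooth H"
    unfolding H_def
    by (intro smooth_add smooth_mult smooth_poly smooth_bounded_linear lin)
  let ?E = "blinfun_inner_left e"
  define D where "D i \<alpha> = (\<lambda>q :: 'q \<times> 'q dual \<times> 'q dual. h i \<alpha> * (fst q \<bullet> e)
      + blinfun_apply (fst (snd q)) e * v \<alpha> i + blinfun_apply (snd (snd q)) e * w i \<alpha>)" for i \<alpha>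
  have HD: "(H has_derivative D i \<alpha>) (at (f (i, \<alpha>) *\<^sub>R e, r, s))" for i \<alpha> r s
    unfolding H_def D_def
    by (auto intro!: derivative_eq_intros has_derivative_poly_compose simp: e pg pv pw)
  define V :: "'q^'r^'s" where "V = (\<chi> i \<alpha>. v \<alpha> i *\<^sub>R e)"
  define W :: "'q^'r^'s" where "W = (\<chi> i \<alpha>. w i \<alpha> *\<^sub>R e)"
  define X where "X = (\<chi> i \<alpha>. x i \<alpha> *\<^sub>R ?E)"
  define Y where "Y = (\<chi> i \<alpha>. y i \<alpha> *\<^sub>R ?E)"
  define lam where "lam = (\<chi> i \<alpha>. l i \<alpha> *\<^sub>R ?E)"
  have stages: "\<Phi>_time dt T 0 V i \<alpha> = f (i, \<alpha>) *\<^sub>R e" "\<Phi>_space dx S 0 W i \<alpha> = f (i, \<alpha>) *\<^sub>R e"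
    "P_time dt T 0 X i \<alpha> = p0 i \<alpha> *\<^sub>R ?E" "P_space dx S 0 Y i \<alpha> = p1 i \<alpha> *\<^sub>R ?E" for i \<alpha>
    using assms(1,2) v[of i \<alpha>] w[of \<alpha> i]
    by (simp_all add: \<Phi>_time_def \<Phi>_space_def P_time_def P_space_def V_def W_def X_def Y_def
        p0_def p1_def scaleR_sum_left[symmetric])
  have convex: "\<theta> *\<^sub>R z + (1 - \<theta>) *\<^sub>R z = z" for z :: 'q
    by (simp flip: scaleR_add_left)
  have "((\<lambda>(u, v, z). K dt dx \<theta> T S H u v 0 0 z) has_derivative
      (\<lambda>(u, v, z). K_deriv dt dx \<theta> T S D 0 0 0 0 (V, W, X, Y, lam) u v z))
      (at (0, 0, V, W, X, Y, lam))"
    by (rule has_derivative_K) (simp only: stages convex HD)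
  moreover have "((\<lambda>z. (0, 0, z)) has_derivative (\<lambda>z. (0, 0, z))) (at (V, W, X, Y, lam))"
    by (auto intro!: derivative_eq_intros)
  ultimately have der: "(K dt dx \<theta> T S H 0 0 0 0 has_derivative
      (\<lambda>z. K_deriv dt dx \<theta> T S D 0 0 0 0 (V, W, X, Y, lam) 0 0 z)) (at (V, W, X, Y, lam))"
    by (auto dest: has_derivative_compose[rotated])
  have "K_deriv dt dx \<theta> T S D 0 0 0 0 (V, W, X, Y, lam) 0 0 (V', W', X', Y', lam') = 0"
    for V' W' X' Y' lam'
  proof -
    let ?d\<Phi> = "\<lambda>i \<alpha>. \<Phi>_time dt T 0 V' i \<alpha>" and ?d\<Phi>' = "\<lambda>i \<alpha>. \<Phi>_space dx S 0 W' i \<alpha>"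
      and ?dP0 = "\<lambda>i \<alpha>. P_time dt T 0 X' i \<alpha>" and ?dP1 = "\<lambda>i \<alpha>. P_space dx S 0 Y' i \<alpha>"
      and ?c = "\<lambda>i \<alpha>. dt * dx * rk_b T i * rk_b S \<alpha>"
    let ?m = "\<lambda>i \<alpha>. M \<alpha> i * (?d\<Phi> i \<alpha> \<bullet> e) - ?c i \<alpha> * p0 i \<alpha> * (V' $ i $ \<alpha> \<bullet> e)"
      and ?n = "\<lambda>i \<alpha>. N i \<alpha> * (?d\<Phi>' i \<alpha> \<bullet> e) - ?c i \<alpha> * p1 i \<alpha> * (W' $ i $ \<alpha> \<bullet> e)"
    \<comment> \<open>The boundary terms vanish with the boundary momenta, and the
      \<open>lam'\<close> terms vanish because both field stages agree.\<close>
    have "K_deriv dt dx \<theta> T S D 0 0 0 0 (V, W, X, Y, lam) 0 0 (V', W', X', Y', lam')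
      = (\<Sum>i\<in>UNIV. \<Sum>\<alpha>\<in>UNIV.
          - (?c i \<alpha> * (p0 i \<alpha> * (V' $ i $ \<alpha> \<bullet> e) + blinfun_apply (?dP0 i \<alpha>) (V $ i $ \<alpha>)))
          - ?c i \<alpha> * (p1 i \<alpha> * (W' $ i $ \<alpha> \<bullet> e) + blinfun_apply (?dP1 i \<alpha>) (W $ i $ \<alpha>))
          + ?c i \<alpha> * D i \<alpha> (\<theta> *\<^sub>R ?d\<Phi> i \<alpha> + (1 - \<theta>) *\<^sub>R ?d\<Phi>' i \<alpha>, ?dP0 i \<alpha>, ?dP1 i \<alpha>)
          + l i \<alpha> * (?d\<Phi> i \<alpha> \<bullet> e - ?d\<Phi>' i \<alpha> \<bullet> e))"
      by (simp add: K_deriv_def Let_def stages lam_def blinfun.bilinear_simps inner_diff_left sum.distrib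
          sum_subtractf sum_negf sum_distrib_left mult.assoc right_diff_distrib)
    \<comment> \<open>The variations of the momenta cancel since the momentum derivatives of
      \<open>H\<close> are \<open>v\<close> and \<open>w\<close>, the coefficients of
      \<open>V\<close> and \<open>W\<close>. The choice of \<open>h\<close> and \<open>l\<close>
      splits the rest into a part in \<open>V'\<close> and a part in \<open>W'\<close>.\<close>
    also have "\<dots> = (\<Sum>i\<in>UNIV. \<Sum>\<alpha>\<in>UNIV. ?m i \<alpha> + ?n i \<alpha>)"
    proof (intro sum.cong refl)
      fix i \<alpha>
      have "?c i \<alpha> * h i \<alpha> = M \<alpha> i + N i \<alpha>"
        using assms(1,2) bT bS by (simp add: h_def)
      then have "?c i \<alpha> * (h i \<alpha> * t) = (M \<alpha> i + N i \<alpha>) * t" for t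
        by (simp only: mult.assoc[symmetric])
      then show "- (?c i \<alpha> * (p0 i \<alpha> * (V' $ i $ \<alpha> \<bullet> e) + blinfun_apply (?dP0 i \<alpha>) (V $ i $ \<alpha>)))
          - ?c i \<alpha> * (p1 i \<alpha> * (W' $ i $ \<alpha> \<bullet> e) + blinfun_apply (?dP1 i \<alpha>) (W $ i $ \<alpha>))
          + ?c i \<alpha> * D i \<alpha> (\<theta> *\<^sub>R ?d\<Phi> i \<alpha> + (1 - \<theta>) *\<^sub>R ?d\<Phi>' i \<alpha>, ?dP0 i \<alpha>, ?dP1 i \<alpha>)
          + l i \<alpha> * (?d\<Phi> i \<alpha> \<bullet> e - ?d\<Phi>' i \<alpha> \<bullet> e) = ?m i \<alpha> + ?n i \<alpha>"
        by (simp only: D_def fst_conv snd_conv distrib_left)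
          (simp add: V_def W_def l_def blinfun.bilinear_simps inner_add_left algebra_simps)
    qed
    also have "\<dots> = (\<Sum>i\<in>UNIV. \<Sum>\<alpha>\<in>UNIV. ?m i \<alpha>) + (\<Sum>i\<in>UNIV. \<Sum>\<alpha>\<in>UNIV. ?n i \<alpha>)"
      by (simp add: sum.distrib)
    \<comment> \<open>Interchanging sums moves the matrix from the variation onto \<open>M\<close>,
      where the transposed system applies.\<close>
    also have "(\<Sum>i\<in>UNIV. \<Sum>\<alpha>\<in>UNIV. ?m i \<alpha>) = 0"
    proof -
      have "(\<Sum>i\<in>UNIV. M \<alpha> i * (?d\<Phi> i \<alpha> \<bullet> e)) = (\<Sum>j\<in>UNIV. ?c j \<alpha> * p0 j \<alpha> * (V' $ j $ \<alpha> \<bullet> e))"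
        for \<alpha>
      proof -
        have "(\<Sum>i\<in>UNIV. M \<alpha> i * (?d\<Phi> i \<alpha> \<bullet> e))
            = (\<Sum>i\<in>UNIV. \<Sum>j\<in>UNIV. dt * (M \<alpha> i * rk_A T $ i $ j) * (V' $ j $ \<alpha> \<bullet> e))"
          by (simp add: \<Phi>_time_def inner_sum_left sum_distrib_left ac_simps)
        also have "\<dots> = (\<Sum>j\<in>UNIV. dt * (\<Sum>i\<in>UNIV. M \<alpha> i * rk_A T $ i $ j) * (V' $ j $ \<alpha> \<bullet> e))"
          by (subst sum.swap) (simp add: sum_distrib_left sum_distrib_right)
        finally show ?thesis by (simp add: M mult.assoc)
      qed
      then show ?thesis
        by (subst sum.swap) (simp add: sum_subtractf)
    qed
    also have "(\<Sum>i\<in>UNIV. \<Sum>\<alpha>\<in>UNIV. ?n i \<alpha>) = 0"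
    proof -
      have "(\<Sum>\<alpha>\<in>UNIV. N i \<alpha> * (?d\<Phi>' i \<alpha> \<bullet> e)) = (\<Sum>\<beta>\<in>UNIV. ?c i \<beta> * p1 i \<beta> * (W' $ i $ \<beta> \<bullet> e))"
        for i
      proof -
        have "(\<Sum>\<alpha>\<in>UNIV. N i \<alpha> * (?d\<Phi>' i \<alpha> \<bullet> e))
            = (\<Sum>\<alpha>\<in>UNIV. \<Sum>\<beta>\<in>UNIV. dx * (N i \<alpha> * rk_A S $ \<alpha> $ \<beta>) * (W' $ i $ \<beta> \<bullet> e))"
          by (simp add: \<Phi>_space_def inner_sum_left sum_distrib_left ac_simps)
        also have "\<dots> = (\<Sum>\<beta>\<in>UNIV. dx * (\<Sum>\<alpha>\<in>UNIV. N i \<alpha> * rk_A S $ \<alpha> $ \<beta>) * (W' $ i $ \<beta> \<bullet> e))"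
          by (subst sum.swap) (simp add: sum_distrib_left sum_distrib_right)
        finally show ?thesis by (simp add: N ac_simps)
      qed
      then show ?thesis
        by (simp add: sum_subtractf)
    qed
    finally show ?thesis by simp
  qed
  with der have "stationary_point (K dt dx \<theta> T S H 0 0 0 0) (V, W, X, Y, lam)"
    unfolding stationary_point_def by (auto elim!: has_derivative_eq_rhs)
  with smooth show thesis
    unfolding X_def Y_def by (rule that)
qed

section \<open>Equivalence of well-definedness and symplecticity\<close>

lemma well_defined_method_iff_symplectic:
  fixes T :: "'s::finite prk" and S :: "'r::finite prk"
  assumes "dt \<noteq> 0" "dx \<noteq> 0" "\<And>i. rk_b T i \<noteq> 0" "\<And>\<alpha>. rk_b S \<alpha> \<noteq> 0"
    and "invertible (rk_A T)" "invertible (rk_A S)"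
  shows "well_defined_method TYPE('q::euclidean_space) dt dx \<theta> T S \<longleftrightarrow> symplectic T \<and> symplectic S"
proof
  assume "symplectic T \<and> symplectic S"
  then show "well_defined_method TYPE('q) dt dx \<theta> T S"
    unfolding well_defined_method_def expansion_momentum_time_def expansion_momentum_space_def
    by (simp add: symplectic_iff_transported_weight hamilton_momentum_time_eq
        hamilton_momentum_space_eq assms)
next
  assume wd: "well_defined_method TYPE('q) dt dx \<theta> T S"
  \<comment> \<open>The existence of a unit vector is where \<open>Q\<close> being nonzero
    enters.\<close>
  obtain e :: 'q where "e \<in> Basis"
    using nonempty_Basis by blast
  then have e: "e \<bullet> e = 1"
    by simp
  have *: "transported_weight T k = mom_b T k \<and> transported_weight S \<gamma> = mom_b S \<gamma>" for k \<gamma>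
  proof -
    \<comment> \<open>Test momenta concentrated at the temporal index \<open>k\<close> and the
      spatial index \<open>\<gamma>\<close>: comparing the two formulas for the boundary momenta and
      pairing with \<open>e\<close> isolates one weight in each direction.\<close>
    let ?X = "(\<chi> i \<alpha>. (if i = k then 1 else 0) *\<^sub>R blinfun_inner_left e) :: 'q dual^'r^'s"
      and ?Y = "(\<chi> i \<alpha>. (if \<alpha> = \<gamma> then 1 else 0) *\<^sub>R blinfun_inner_left e) :: 'q dual^'r^'s"
    obtain H :: "'q \<times> 'q dual \<times> 'q dual \<Rightarrow> real" and V W lam where sm: "smooth H"
      and st: "stationary_point (K dt dx \<theta> T S H 0 0 0 0) (V, W, ?X, ?Y, lam)"
      using ex_stationary_point[OF assms e, of \<theta> "\<lambda>i \<alpha>. if i = k then 1 else 0" "\<lambda>i \<alpha>. if \<alpha> = \<gamma> then 1 else 0"]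
      by blast
    have "blinfun_apply (\<Sum>j\<in>UNIV. transported_weight T j *\<^sub>R ?X $ j $ \<alpha>) e
        = blinfun_apply (\<Sum>j\<in>UNIV. mom_b T j *\<^sub>R ?X $ j $ \<alpha>) e" for \<alpha>
      using wd sm st hamilton_momentum_time_eq[OF sm assms(1,2,4,5) st, of \<alpha>] assms(1)
      unfolding well_defined_method_def expansion_momentum_time_def by simp
    moreover have "blinfun_apply (\<Sum>\<beta>\<in>UNIV. transported_weight S \<beta> *\<^sub>R ?Y $ i $ \<beta>) e
        = blinfun_apply (\<Sum>\<beta>\<in>UNIV. mom_b S \<beta> *\<^sub>R ?Y $ i $ \<beta>) e" for i
      using wd sm st hamilton_momentum_space_eq[OF sm assms(1,2,3,6) st, of i] assms(2)
      unfolding well_defined_method_def expansion_momentum_space_def by simp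
    ultimately show ?thesis
      by (simp add: blinfun.sum_left blinfun.bilinear_simps e if_distrib[of "\<lambda>x. _ * x"] cong: if_cong)
  qed
  then show "symplectic T \<and> symplectic S"
    by (simp add: symplectic_iff_transported_weight)
qed

theorem proposition2p5:
  fixes dt dx \<theta> :: real
    and c :: "'s::finite \<Rightarrow> real" and \<psi> :: "'s \<Rightarrow> real \<Rightarrow> real"
    and c' :: "'r::finite \<Rightarrow> real" and \<psi>' :: "'r \<Rightarrow> real \<Rightarrow> real"
    and T :: "'s prk" and S :: "'r prk"
    and AT :: "real^'s^'s" and bT :: "'s \<Rightarrow> real"
    and AS :: "real^'r^'r" and bS :: "'r \<Rightarrow> real"
  assumes "0 < dt" and "0 < dx"
    and "nodal_basis c \<psi>" and "nodal_basis c' \<psi>'"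
    and "T = collocation_prk c \<psi> AT bT" and "S = collocation_prk c' \<psi>' AS bS"
    and "admissible_weights T" and "admissible_weights S"
    and "invertible (rk_A T)" and "invertible (rk_A S)"
  shows "(well_defined_method TYPE('q::euclidean_space) dt dx \<theta> T S
            \<longleftrightarrow> symplectic T \<and> symplectic S)
       \<and> (usual_symplectic_choice T \<and> usual_symplectic_choice S
            \<longrightarrow> well_defined_method TYPE('q) dt dx \<theta> T S)"
proof -
  have T: "\<And>i. rk_b T i \<noteq> 0" and S: "\<And>\<alpha>. rk_b S \<alpha> \<noteq> 0"
    using assms(7,8) by (simp_all add: admissible_weights_def)
  have "well_defined_method TYPE('q) dt dx \<theta> T S \<longleftrightarrow> symplectic T \<and> symplectic S"
    using assms(1,2) T S assms(9,10) by (intro well_defined_method_iff_symplectic) auto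
  then show ?thesis
    using usual_symplectic_choice_imp_symplectic[OF _ T assms(9)]
      usual_symplectic_choice_imp_symplectic[OF _ S assms(10)] by blast
qed

end
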